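(* Let $(H,\langle\cdot,\cdot\rangle_H)$ be a Hilbert space, let $(E,\|\cdot\|_E)$ be a Banach space, and let $0<\alpha\leq 1$ and $L\geq 0$ be real numbers. If $X\subset H$ is a finite subset, $S\subset X$, and $f\colon S\to E$ is an $(\alpha,L)$-Hölder map, then there is an extension $\overline{f}\colon X\to\overline{\operatorname{conv}}(f(S))$ of $f$ such that $\overline{f}$ is an $(\alpha,\overline{L})$-Hölder map with $$\overline{L}\leq\left(\sqrt{m+1}\right)^{\alpha}L,$$ where $m:=|X\setminus S|$.
   Context: For real numbers $0<\alpha\leq1$ and $L\geq 0$, an $(\alpha,L)$-Hölder map between metric spaces $(A,d_A)$ and $(B,d_B)$ is a map $f\colon A\to B$ with $d_B(f(x),f(x'))\leq L\,d_A(x,x')^{\alpha}$ for all $x,x'\in A$. Subsets of $H$ and $E$ carry the metrics induced by the norms. $\overline{\operatorname{conv}}$ denotes the closed convex hull and $|\cdot|$ the cardinality. *)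

theory Defs
  imports "HOL-Analysis.Analysis"
begin

(* Since 0 powr \<alpha> = 0, the inequality is also the intended one for x = x'. *)
definition hoelder_map ::
  "real \<Rightarrow> real \<Rightarrow> 'a::metric_space set \<Rightarrow> 'b::metric_space set \<Rightarrow> ('a \<Rightarrow> 'b) \<Rightarrow> bool"
  where "hoelder_map \<alpha> L A B f \<longleftrightarrow>
    0 < \<alpha> \<and> \<alpha> \<le> 1 \<and> 0 \<le> L \<and> f \<in> A \<rightarrow> B \<and>
    (\<forall>x\<in>A. \<forall>x'\<in>A. dist (f x) (f x') \<le> L * dist x x' powr \<alpha>)"

end

theory Submission
  imports Defs
begin

text \<open>
  Put \<open>T = X - S\<close> and \<open>m = card T\<close>. The extension is \<open>g x = E (f (R x))\<close>, where \<open>R\<close> is a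
  random retraction of \<open>X\<close> onto \<open>S\<close> that depends neither on \<open>f\<close> nor on \<open>\<alpha>\<close> and satisfies
  \<open>E (dist (R x) (R y))\<^sup>2 \<le> (m + 1) * (dist x y)\<^sup>2\<close> for all \<open>x\<close>, \<open>y\<close> in \<open>X\<close>
  (\<open>ex_random_retraction\<close>). Concavity of \<open>t \<mapsto> t powr (\<alpha> / 2)\<close> turns this into
  \<open>E (dist (R x) (R y) powr \<alpha>) \<le> sqrt (m + 1) powr \<alpha> * dist x y powr \<alpha>\<close>, which is the required
  estimate; the values of \<open>g\<close> are convex combinations of values of \<open>f\<close>.

  A single law for \<open>R\<close> must serve all pairs at once. By a minimax argument (\<open>finite_minimax\<close>)
  such a law exists as soon as, for every choice of positive weights \<open>w\<close> on the pairs, some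
  retraction increases the energy \<open>\<Sum> w x y * (dist x y)\<^sup>2\<close> by a factor of at most \<open>m + 1\<close>
  (\<open>ex_forest_energy_le\<close>). To find it, view \<open>w\<close> as the conductances of an electrical network on
  \<open>X\<close>, draw a spanning forest rooted at \<open>S\<close> with probability proportional to the product of the
  weights of its edges, and send each point to the root of its tree.

  To see why this works, add to a forest an edge that joins two of its trees, with roots \<open>s\<close> and
  \<open>t\<close>. In the resulting graph \<open>s\<close> and \<open>t\<close> are joined by a path, and the same graph arises once
  from each edge of this path. Hence a sum over pairs (forest, edge between different trees) is
  a sum over graphs followed by a sum along a path. Summing \<open>1\<close> along the path counts its edges,
  and there are at most \<open>m + 1\<close> of them (\<open>cut_sum_le_last\<close>). Summing the increments \<open>z i - z j\<close>
  telescopes to \<open>z s - z t\<close> (\<open>cut_sum_flow\<close>); applying this to the mean root position and to the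
  given points, together with \<open>2 * (u \<bullet> v) \<le> (norm u)\<^sup>2 + (norm v)\<^sup>2\<close>, bounds what is left by the
  energy of the given points (\<open>last_cut_sum_le_energy\<close>). The graphs never appear explicitly: moving the
  distinguished edge one step along its path is a weight-preserving bijection (\<open>shift_cut\<close>,
  \<open>shift_sum\<close>), and this suffices for telescoping.
\<close>


section \<open>A finite minimax principle\<close>

lemma compact_simplex:
  assumes "finite A"
  shows "compact {\<mu> :: 'a \<Rightarrow> real. (\<forall>x. 0 \<le> \<mu> x) \<and> (\<forall>x. x \<notin> A \<longrightarrow> \<mu> x = 0) \<and> sum \<mu> A = 1}"
    (is "compact ?P")
proof -
  let ?B = "\<lambda>x. if x \<in> A then {0..1::real} else {0}"
  have "compactin (product_topology (\<lambda>_. euclidean) UNIV) (PiE UNIV ?B)"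
    by (subst compactin_PiE) auto
  then have "compact (PiE UNIV ?B)"
    by (simp add: euclidean_product_topology)
  moreover have "closed {\<mu> :: 'a \<Rightarrow> real. sum \<mu> A = 1}"
    by (intro closed_Collect_eq continuous_intros continuous_on_product_coordinates)
  moreover have "?P = PiE UNIV ?B \<inter> {\<mu>. sum \<mu> A = 1}"
  proof (rule set_eqI, rule iffI)
    fix \<mu> assume mu: "\<mu> \<in> ?P"
    have "\<mu> x \<le> 1" if "x \<in> A" for x
      using member_le_sum[of x A \<mu>] that mu assms by auto
    then show "\<mu> \<in> PiE UNIV ?B \<inter> {\<mu>. sum \<mu> A = 1}"
      using mu by (auto simp: PiE_iff)
  next
    fix \<mu> assume mu: "\<mu> \<in> PiE UNIV ?B \<inter> {\<mu>. sum \<mu> A = 1}"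
    then have "\<mu> x \<in> ?B x" for x by (auto simp: PiE_iff)
    then have "0 \<le> \<mu> x" "x \<notin> A \<longrightarrow> \<mu> x = 0" for x
      by (metis atLeastAtMost_iff order_refl singletonD, metis singletonD)
    with mu show "\<mu> \<in> ?P" by auto
  qed
  ultimately show ?thesis by (simp add: compact_Int_closed)
qed

text \<open>
  The passage to the limit of vanishing perturbations of the weights uses the finiteness of
  \<open>A\<close>: the finitely many strict inequalities survive a common small perturbation.
\<close>

lemma nonneg_weights_from_pos_weights:
  fixes a :: "'k \<Rightarrow> 'o \<Rightarrow> real"
  assumes "finite A"
    and pos: "\<And>w. (\<And>k. k \<in> K \<Longrightarrow> 0 < w k) \<Longrightarrow> \<exists>x\<in>A. (\<Sum>k\<in>K. w k * a k x) \<le> 0"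
    and w: "\<And>k. k \<in> K \<Longrightarrow> 0 \<le> w k"
  shows "\<exists>x\<in>A. (\<Sum>k\<in>K. w k * a k x) \<le> 0"
proof (rule ccontr)
  assume "\<not> ?thesis"
  then have gt: "0 < (\<Sum>k\<in>K. w k * a k x)" if "x \<in> A" for x using that by force
  have "\<forall>\<^sub>F e in at_right 0. 0 < (\<Sum>k\<in>K. (w k + e) * a k x)" if "x \<in> A" for x
  proof -
    have "((\<lambda>e. \<Sum>k\<in>K. (w k + e) * a k x) \<longlongrightarrow> (\<Sum>k\<in>K. (w k + 0) * a k x)) (at_right 0)"
      by (intro tendsto_intros)
    with gt[OF that] show ?thesis by (auto intro: order_tendstoD)
  qed
  with \<open>finite A\<close> have "\<forall>\<^sub>F e in at_right 0. \<forall>x\<in>A. 0 < (\<Sum>k\<in>K. (w k + e) * a k x)"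
    by (simp add: eventually_ball_finite)
  then have "\<forall>\<^sub>F e::real in at_right 0. e > 0 \<and> (\<forall>x\<in>A. 0 < (\<Sum>k\<in>K. (w k + e) * a k x))"
    using eventually_at_right_less eventually_conj by blast
  then obtain e :: real where "e > 0" and e: "\<forall>x\<in>A. 0 < (\<Sum>k\<in>K. (w k + e) * a k x)"
    using eventually_happens'[OF trivial_limit_at_right_real] by blast
  then show False
    using pos[of "\<lambda>k. w k + e"] w by (force intro: add_nonneg_pos)
qed

text \<open>
  Let \<open>\<mu>\<close> minimize the sum of the squared positive parts of the means \<open>\<Sum>x\<in>A. \<mu> x * a k x\<close> over
  the probability vectors on \<open>A\<close>. If some mean were positive, then the positive parts would be
  weights for which some \<open>x\<close> makes the weighted sum nonpositive, and moving a little mass of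
  \<open>\<mu>\<close> to that \<open>x\<close> would decrease the minimum.
\<close>

lemma finite_minimax:
  fixes a :: "'k \<Rightarrow> 'o \<Rightarrow> real"
  assumes "finite A" and "finite K"
    and pos: "\<And>w. (\<And>k. k \<in> K \<Longrightarrow> 0 < w k) \<Longrightarrow> \<exists>x\<in>A. (\<Sum>k\<in>K. w k * a k x) \<le> 0"
  shows "\<exists>\<mu>. (\<forall>x. 0 \<le> \<mu> x) \<and> sum \<mu> A = 1 \<and> (\<forall>k\<in>K. (\<Sum>x\<in>A. \<mu> x * a k x) \<le> 0)"
proof -
  define P where "P = {\<mu> :: 'o \<Rightarrow> real. (\<forall>x. 0 \<le> \<mu> x) \<and> (\<forall>x. x \<notin> A \<longrightarrow> \<mu> x = 0) \<and> sum \<mu> A = 1}"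
  define V where "V = (\<lambda>\<mu> k. \<Sum>x\<in>A. \<mu> x * a k x)"
  define G where "G = (\<lambda>\<mu>. \<Sum>k\<in>K. (max 0 (V \<mu> k))\<^sup>2)"
  obtain x0 where x0: "x0 \<in> A" using pos[of "\<lambda>_. 1"] by auto
  then have "(\<lambda>x. if x = x0 then 1 else 0) \<in> P"
    using \<open>finite A\<close> by (auto simp: P_def)
  then have "P \<noteq> {}" by auto
  moreover have "continuous_on P G"
    unfolding G_def V_def
    by (intro continuous_intros continuous_on_product_coordinates
        continuous_on_subset[OF continuous_on_product_coordinates subset_UNIV])
  ultimately obtain \<mu> where mu: "\<mu> \<in> P" and min: "\<And>\<nu>. \<nu> \<in> P \<Longrightarrow> G \<mu> \<le> G \<nu>"
    using continuous_attains_inf[of P G] compact_simplex[OF \<open>finite A\<close>] by (auto simp: P_def)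
  define w where "w = (\<lambda>k. max 0 (V \<mu> k))"
  obtain x where x: "x \<in> A" and wx: "(\<Sum>k\<in>K. w k * a k x) \<le> 0"
    using nonneg_weights_from_pos_weights[OF \<open>finite A\<close> pos, where w = w] by (auto simp: w_def)
  define b where "b = (\<lambda>k. a k x - V \<mu> k)"
  have wb: "(\<Sum>k\<in>K. w k * b k) \<le> - G \<mu>"
  proof -
    have "(\<Sum>k\<in>K. w k * V \<mu> k) = G \<mu>"
      unfolding G_def w_def by (rule sum.cong) (auto simp: max_def power2_eq_square)
    then show ?thesis using wx by (simp add: b_def right_diff_distrib sum_subtractf)
  qed
  \<comment> \<open>Compare \<open>\<mu>\<close> with the mixture that puts extra mass \<open>e\<close> on \<open>x\<close>.\<close>
  have step: "G \<mu> \<le> G \<mu> - 2 * e * G \<mu> + e\<^sup>2 * (\<Sum>k\<in>K. (b k)\<^sup>2)" if e: "0 \<le> e" "e \<le> 1" for e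
  proof -
    define \<nu> where "\<nu> = (\<lambda>y. (1 - e) * \<mu> y + e * (if y = x then 1 else 0))"
    have "sum \<nu> A = (1 - e) * sum \<mu> A + e"
      using x \<open>finite A\<close> by (simp add: \<nu>_def sum.distrib sum_distrib_left[symmetric])
    then have "\<nu> \<in> P" using mu e x by (auto simp: P_def \<nu>_def)
    have V: "V \<nu> k = V \<mu> k + e * b k" for k
    proof -
      have "V \<nu> k = (\<Sum>y\<in>A. (1 - e) * (\<mu> y * a k y) + e * (if y = x then a k x else 0))"
        unfolding V_def \<nu>_def by (rule sum.cong) (auto simp: algebra_simps)
      also have "\<dots> = (1 - e) * V \<mu> k + e * a k x"
        using x \<open>finite A\<close> by (simp add: V_def sum.distrib sum_distrib_left[symmetric])
      finally show ?thesis by (simp add: b_def algebra_simps)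
    qed
    have "(max 0 (V \<nu> k))\<^sup>2 \<le> (w k + e * b k)\<^sup>2" for k
    proof (cases "V \<mu> k \<ge> 0")
      case True
      then show ?thesis by (auto simp: V w_def max_def)
    next
      case False
      then show ?thesis unfolding V w_def
        by (auto simp: max_def intro!: power_mono)
    qed
    then have "G \<nu> \<le> (\<Sum>k\<in>K. (w k + e * b k)\<^sup>2)"
      unfolding G_def by (intro sum_mono) auto
    also have "\<dots> = (\<Sum>k\<in>K. (w k)\<^sup>2 + 2 * e * (w k * b k) + e\<^sup>2 * (b k)\<^sup>2)"
      by (rule sum.cong) (auto simp: power2_eq_square algebra_simps)
    also have "\<dots> = G \<mu> + 2 * e * (\<Sum>k\<in>K. w k * b k) + e\<^sup>2 * (\<Sum>k\<in>K. (b k)\<^sup>2)"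
      by (simp add: sum.distrib sum_distrib_left G_def w_def)
    also have "2 * e * (\<Sum>k\<in>K. w k * b k) \<le> 2 * e * (- G \<mu>)"
      using wb e by (intro mult_left_mono) auto
    finally show ?thesis using min[OF \<open>\<nu> \<in> P\<close>] by simp
  qed
  define B where "B = (\<Sum>k\<in>K. (b k)\<^sup>2)"
  have B0: "B \<ge> 0" by (simp add: B_def sum_nonneg)
  have G0: "G \<mu> \<ge> 0" by (simp add: G_def sum_nonneg)
  have "G \<mu> = 0"
  proof (rule ccontr)
    assume "G \<mu> \<noteq> 0"
    with G0 have Gp: "G \<mu> > 0" by simp
    \<comment> \<open>This \<open>e\<close> makes the quadratic term \<open>e\<^sup>2 * B\<close> smaller than the linear gain \<open>2 * e * G \<mu>\<close>.\<close>
    define e where "e = G \<mu> / (G \<mu> + B)"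
    have e: "0 < e" "e \<le> 1" using Gp B0 by (auto simp: e_def)
    have "e * (2 * G \<mu>) \<le> e * (e * B)" using step[of e] e
      by (simp add: B_def power2_eq_square algebra_simps)
    then have "2 * G \<mu> \<le> e * B" using e by simp
    also have "\<dots> \<le> G \<mu>" using Gp B0 by (simp add: e_def field_simps)
    finally show False using Gp by simp
  qed
  then have "V \<mu> k \<le> 0" if "k \<in> K" for k
    using that \<open>finite K\<close> by (auto simp: G_def sum_nonneg_eq_0_iff max_def split: if_splits)
  with mu show ?thesis by (auto simp: P_def V_def)
qed


section \<open>Rooted forests\<close>

text \<open>
  A forest on \<open>X\<close> whose roots are the points outside \<open>T\<close> is encoded by the function \<open>p\<close> that maps
  each point of \<open>T\<close> to its parent. The relation \<open>leads T p v s n\<close> says that following parents from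
  \<open>v\<close> arrives outside \<open>T\<close> after exactly \<open>n\<close> steps, at the point \<open>s\<close>.
\<close>

inductive leads :: "'v set \<Rightarrow> ('v \<Rightarrow> 'v) \<Rightarrow> 'v \<Rightarrow> 'v \<Rightarrow> nat \<Rightarrow> bool"
  for T :: "'v set" and p :: "'v \<Rightarrow> 'v" where
  stop: "s \<notin> T \<Longrightarrow> leads T p s s 0"
| step: "v \<in> T \<Longrightarrow> leads T p (p v) s n \<Longrightarrow> leads T p v s (Suc n)"

lemma leads_unique:
  assumes "leads T p v s n" "leads T p v s' n'"
  shows "s' = s \<and> n' = n"
  using assms
proof (induction arbitrary: s' n' rule: leads.induct)
  case (stop s)
  then show ?case by (auto elim: leads.cases)
next
  case (step v s n)
  from step.prems step.hyps(1) obtain m where "n' = Suc m" "leads T p (p v) s' m"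
    by (auto elim: leads.cases)
  then show ?case using step.IH by auto
qed

lemma leads_end: "leads T p v s n \<Longrightarrow> s \<notin> T"
  by (induction rule: leads.induct) auto

text \<open>
  Either alternative in the last premise keeps \<open>j\<close> off the path from \<open>v\<close> to its root, so a new
  parent for \<open>j\<close> leaves that path unchanged.
\<close>

lemma leads_redirect:
  assumes "leads T p v s n" and "leads T p j t d" and "s \<noteq> t \<or> n < d"
  shows "leads T (p(j := i)) v s n"
  using assms(1,3)
proof (induction rule: leads.induct)
  case (stop s)
  then show ?case by (simp add: leads.stop)
next
  case (step v s n)
  have "v \<noteq> j"
    using leads_unique[OF assms(2), of s "Suc n"] leads.step[OF step.hyps] step.prems by auto
  with step show ?case by (auto intro: leads.step)
qed

text \<open>
  The path visits no point of \<open>T\<close> twice, because the distance to the root drops at each step.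
\<close>

lemma leads_length_le:
  assumes "leads T p v s n" and "finite T"
  shows "n \<le> card T"
proof -
  have "\<exists>D\<subseteq>T. card D = n \<and> (\<forall>u\<in>D. \<exists>d\<le>n. leads T p u s d)"
    using assms(1)
  proof (induction rule: leads.induct)
    case (stop s)
    then show ?case by (intro exI[of _ "{}"]) auto
  next
    case (step v s n)
    then obtain D where D: "D \<subseteq> T" "card D = n" "\<forall>u\<in>D. \<exists>d\<le>n. leads T p u s d" by auto
    have v: "leads T p v s (Suc n)" using step.hyps by (rule leads.step)
    have "v \<notin> D"
    proof
      assume "v \<in> D"
      with D obtain d where "d \<le> n" "leads T p v s d" by auto
      with leads_unique[OF v] show False by fastforce
    qed
    moreover have "finite D" using D(1) \<open>finite T\<close> finite_subset by auto
    moreover have "\<exists>d\<le>Suc n. leads T p u s d" if "u \<in> insert v D" for u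
    proof (cases "u = v")
      case True
      with v show ?thesis by auto
    next
      case False
      with D(3) that obtain d where "d \<le> n" "leads T p u s d" by auto
      then show ?thesis by (intro exI[of _ d]) simp
    qed
    ultimately show ?case
      using D(1,2) step.hyps(1) by (intro exI[of _ "insert v D"]) simp
  qed
  then show ?thesis using card_mono[OF \<open>finite T\<close>] by auto
qed

definition tree_root :: "'v set \<Rightarrow> ('v \<Rightarrow> 'v) \<Rightarrow> 'v \<Rightarrow> 'v" where
  "tree_root T p v = (THE s. \<exists>n. leads T p v s n)"

definition depth :: "'v set \<Rightarrow> ('v \<Rightarrow> 'v) \<Rightarrow> 'v \<Rightarrow> nat" where
  "depth T p v = (THE n. \<exists>s. leads T p v s n)"

lemma leads_root_depth:
  assumes "leads T p v s n"
  shows "tree_root T p v = s" "depth T p v = n"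
  unfolding tree_root_def depth_def using assms leads_unique[OF assms] by blast+

text \<open>
  Existence of a root for every point excludes cycles. Parent functions are extensional so that
  there are only finitely many of them.
\<close>

definition forests :: "'v set \<Rightarrow> 'v set \<Rightarrow> ('v \<Rightarrow> 'v) set" where
  "forests T X = {p \<in> T \<rightarrow>\<^sub>E X. \<forall>v\<in>T. \<exists>s n. leads T p v s n}"

lemma finite_forests:
  assumes "finite X" "T \<subseteq> X" shows "finite (forests T X)"
  using finite_PiE[of T "\<lambda>_. X"] finite_subset[OF assms(2,1)] assms(1)
  by (auto simp: forests_def)

lemma forest_leads:
  assumes "p \<in> forests T X"
  shows "leads T p v (tree_root T p v) (depth T p v)"
proof -
  obtain s n where "leads T p v s n"
    using assms leads.stop[of v T p] by (cases "v \<in> T") (auto simp: forests_def)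
  then show ?thesis using leads_root_depth by metis
qed

lemma root_outside: "v \<notin> T \<Longrightarrow> tree_root T p v = v"
  and depth_outside: "v \<notin> T \<Longrightarrow> depth T p v = 0"
  by (rule leads_root_depth, erule leads.stop)+

lemma root_in:
  assumes "p \<in> forests T X" "v \<in> X"
  shows "tree_root T p v \<in> X - T"
proof -
  have "s \<in> X" if "leads T p v s n" "v \<in> X" for v s n
    using that by (induction rule: leads.induct) (use assms(1) in \<open>auto simp: forests_def\<close>)
  then show ?thesis
    using forest_leads[OF assms(1), of v] assms(2) leads_end[OF forest_leads[OF assms(1), of v]] by simp
qed

section \<open>Weighted forests and paths\<close>

locale weighted_network =
  fixes T X :: "'v set" and w :: "'v \<Rightarrow> 'v \<Rightarrow> real"
  assumes finite_X: "finite X" and T_subset: "T \<subseteq> X"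
    and w_sym: "\<And>i j. w i j = w j i"
    and w_pos: "\<And>i j. i \<in> X \<Longrightarrow> j \<in> X \<Longrightarrow> 0 < w i j"
begin

definition weight :: "('v \<Rightarrow> 'v) \<Rightarrow> real" where
  "weight p = (\<Prod>v\<in>T. w v (p v))"

text \<open>
  A cut is a forest with a directed edge from one of its trees to another.
\<close>

definition cuts :: "(('v \<Rightarrow> 'v) \<times> 'v \<times> 'v) set" where
  "cuts = {(p, i, j). p \<in> forests T X \<and> i \<in> X \<and> j \<in> X \<and> tree_root T p i \<noteq> tree_root T p j}"

lemma finite_T: "finite T"
  using finite_X T_subset finite_subset by blast

lemma finite_cuts: "finite cuts"
  by (rule finite_subset[of _ "forests T X \<times> X \<times> X"])
    (auto simp: cuts_def finite_X finite_forests T_subset)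

lemma weight_pos: "p \<in> forests T X \<Longrightarrow> 0 < weight p"
  unfolding weight_def using T_subset by (auto intro!: prod_pos w_pos simp: forests_def)

lemma swap_cuts: "(p, i, j) \<in> cuts \<Longrightarrow> (p, j, i) \<in> cuts"
  by (auto simp: cuts_def)

text \<open>
  Adding the edge \<open>i\<close>, \<open>j\<close> of a cut to the forest creates a path from the root of \<open>i\<close> to the
  root of \<open>j\<close>. The edge of this path that follows \<open>(i, j)\<close> leads from \<open>j\<close> to its parent \<open>p j\<close>.
  Removing that edge instead of \<open>(i, j)\<close> amounts to making \<open>i\<close> the parent of \<open>j\<close>. The edge set of
  forest and extra edge together is unchanged, and so is the product of its weights.
\<close>

lemma shift_cut:
  assumes c: "(p, i, j) \<in> cuts" and j: "j \<in> T"
  shows "(p(j := i), j, p j) \<in> cuts"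
    and "tree_root T (p(j := i)) j = tree_root T p i"
    and "tree_root T (p(j := i)) (p j) = tree_root T p j"
    and "depth T (p(j := i)) j = Suc (depth T p i)"
    and "weight (p(j := i)) * w j (p j) = weight p * w i j"
proof -
  let ?q = "p(j := i)"
  have p: "p \<in> forests T X" and i: "i \<in> X" and ne: "tree_root T p i \<noteq> tree_root T p j"
    using c by (auto simp: cuts_def)
  note L = forest_leads[OF p]
  obtain n where n: "depth T p j = Suc n" "leads T p (p j) (tree_root T p j) n"
    using L[of j] by (rule leads.cases) (use j in auto)
  have Li: "leads T ?q i (tree_root T p i) (depth T p i)"
    by (rule leads_redirect[OF L L]) (use ne in simp)
  have Lj: "leads T ?q j (tree_root T p i) (Suc (depth T p i))"
    using leads.step[of j T ?q] Li j by simp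
  have Lpj: "leads T ?q (p j) (tree_root T p j) n"
    by (rule leads_redirect[OF n(2) L]) (use n in simp)
  show r1: "tree_root T ?q j = tree_root T p i" and "depth T ?q j = Suc (depth T p i)"
    using leads_root_depth[OF Lj] by auto
  show r2: "tree_root T ?q (p j) = tree_root T p j"
    using leads_root_depth[OF Lpj] by auto
  have "\<exists>s' n'. leads T ?q v s' n'" if "leads T p v s n" for v s n
    using that
  proof (induction rule: leads.induct)
    case (stop s)
    from leads.stop[OF this, of ?q] show ?case by (intro exI)
  next
    case (step v s n)
    show ?case
    proof (cases "v = j")
      case True
      from Lj show ?thesis unfolding True by (intro exI)
    next
      case False
      from step.IH obtain s' n' where "leads T ?q (p v) s' n'" by (elim exE)
      then have "leads T ?q (?q v) s' n'" using False by simp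
      with step.hyps(1) have "leads T ?q v s' (Suc n')" by (rule leads.step)
      then show ?thesis by (intro exI)
    qed
  qed
  then have "\<exists>s n. leads T ?q v s n" for v by this (rule L)
  moreover have "?q \<in> T \<rightarrow>\<^sub>E X"
    using PiE_fun_upd[of i "\<lambda>_. X" j p T] i j p by (auto simp: forests_def insert_absorb)
  ultimately have "?q \<in> forests T X" unfolding forests_def by blast
  moreover have "p j \<in> X" using p j by (auto simp: forests_def)
  ultimately show "(?q, j, p j) \<in> cuts"
    using j T_subset r1 r2 ne by (auto simp: cuts_def)
  have "(\<Prod>v\<in>T - {j}. w v (?q v)) = (\<Prod>v\<in>T - {j}. w v (p v))"
    by (rule prod.cong) auto
  then show "weight ?q * w j (p j) = weight p * w i j"
    using prod.remove[OF finite_T j, of "\<lambda>v. w v (?q v)"] prod.remove[OF finite_T j, of "\<lambda>v. w v (p v)"] w_sym[of i j]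
    by (simp add: weight_def)
qed

text \<open>
  The step along the path is invertible: the inverse is the same step for the path traversed
  backwards. It matches the cuts whose edge is not the last one of its path with those whose edge
  is not the first one.
\<close>

lemma shift_sum:
  fixes G :: "('v \<Rightarrow> 'v) \<Rightarrow> 'v \<Rightarrow> 'v \<Rightarrow> real"
  shows "(\<Sum>(p, i, j)\<in>{(p, i, j)\<in>cuts. j \<in> T}. weight p * w i j * G (p(j := i)) j (p j))
    = (\<Sum>(p, i, j)\<in>{(p, i, j)\<in>cuts. i \<in> T}. weight p * w i j * G p i j)"
    (is "sum ?F ?A = sum ?H ?B")
proof (rule sum.reindex_bij_witness)
  let ?f = "\<lambda>(p, i, j). (p(j := i), j, p j)" and ?g = "\<lambda>(p, i, j). (p(i := j), p i, i)"
  fix c :: "('v \<Rightarrow> 'v) \<times> 'v \<times> 'v"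
  obtain p i j where c: "c = (p, i, j)" by (cases c)
  show "?g (?f c) = c" and "?f (?g c) = c" by (simp_all add: c)
  show "?f c \<in> ?B" if "c \<in> ?A"
    using that shift_cut(1)[of p i j] by (simp add: c)
  show "?g c \<in> ?A" if "c \<in> ?B"
    using that swap_cuts[OF shift_cut(1)[OF swap_cuts, of p i j]] by (simp add: c)
  show "?H (?f c) = ?F c" if "c \<in> ?A"
    using that shift_cut(5)[of p i j] by (simp add: c)
qed

definition cut_sum :: "(('v \<Rightarrow> 'v) \<Rightarrow> 'v \<Rightarrow> 'v \<Rightarrow> real) \<Rightarrow> real" where
  "cut_sum G = (\<Sum>(p, i, j)\<in>cuts. weight p * w i j * G p i j)"

text \<open>
  The edge of a cut is the first one of its path iff it starts at a root, and the last one iff it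
  ends at a root.
\<close>

definition first_cut_sum :: "(('v \<Rightarrow> 'v) \<Rightarrow> 'v \<Rightarrow> 'v \<Rightarrow> real) \<Rightarrow> real" where
  "first_cut_sum G = (\<Sum>(p, i, j)\<in>{(p, i, j)\<in>cuts. i \<notin> T}. weight p * w i j * G p i j)"

definition last_cut_sum :: "(('v \<Rightarrow> 'v) \<Rightarrow> 'v \<Rightarrow> 'v \<Rightarrow> real) \<Rightarrow> real" where
  "last_cut_sum G = (\<Sum>(p, i, j)\<in>{(p, i, j)\<in>cuts. j \<notin> T}. weight p * w i j * G p i j)"

text \<open>
  Think of \<open>A\<close> and \<open>B\<close> as the values of a potential at the start and at the end of the edge. The
  hypothesis says that they agree at a vertex between two consecutive edges of a path, so only
  the values at the two ends of the path remain.
\<close>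

lemma cut_sum_telescope:
  assumes "\<And>p i j. (p, i, j) \<in> cuts \<Longrightarrow> j \<in> T \<Longrightarrow> B p i j = A (p(j := i)) j (p j)"
  shows "cut_sum B - cut_sum A = last_cut_sum B - first_cut_sum A"
proof -
  have "cut_sum B = (\<Sum>(p, i, j)\<in>{(p, i, j)\<in>cuts. j \<in> T}. weight p * w i j * B p i j) + last_cut_sum B"
    unfolding cut_sum_def last_cut_sum_def
    by (subst sum.union_disjoint[symmetric])
      (auto intro!: sum.cong finite_subset[OF _ finite_cuts])
  moreover have "cut_sum A = (\<Sum>(p, i, j)\<in>{(p, i, j)\<in>cuts. i \<in> T}. weight p * w i j * A p i j) + first_cut_sum A"
    unfolding cut_sum_def first_cut_sum_def
    by (subst sum.union_disjoint[symmetric])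
      (auto intro!: sum.cong finite_subset[OF _ finite_cuts])
  moreover have "(\<Sum>(p, i, j)\<in>{(p, i, j)\<in>cuts. j \<in> T}. weight p * w i j * B p i j)
    = (\<Sum>(p, i, j)\<in>{(p, i, j)\<in>cuts. j \<in> T}. weight p * w i j * A (p(j := i)) j (p j))"
    by (rule sum.cong) (auto simp: assms)
  ultimately show ?thesis by (simp add: shift_sum)
qed

text \<open>
  Each path has one first and one last edge, and all its edges separate the same two roots.
\<close>

lemma first_eq_last:
  "first_cut_sum (\<lambda>p i j. c (tree_root T p i) (tree_root T p j))
    = last_cut_sum (\<lambda>p i j. c (tree_root T p i) (tree_root T p j))"
  using cut_sum_telescope[of "\<lambda>p i j. c (tree_root T p i) (tree_root T p j)"
      "\<lambda>p i j. c (tree_root T p i) (tree_root T p j)"] shift_cut(2,3) by simp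

lemma cut_sum_diff: "cut_sum (\<lambda>p i j. G p i j - H p i j) = cut_sum G - cut_sum H"
  and last_cut_sum_diff:
    "last_cut_sum (\<lambda>p i j. G p i j - H p i j) = last_cut_sum G - last_cut_sum H"
  by (simp_all add: cut_sum_def last_cut_sum_def right_diff_distrib sum_subtractf case_prod_unfold)

lemma last_cut_sum_mono:
  assumes "\<And>p i j. (p, i, j) \<in> cuts \<Longrightarrow> j \<notin> T \<Longrightarrow> G p i j \<le> H p i j"
  shows "last_cut_sum G \<le> last_cut_sum H"
  unfolding last_cut_sum_def
  by (rule sum_mono)
    (auto intro!: mult_left_mono assms mult_nonneg_nonneg less_imp_le[OF weight_pos] less_imp_le[OF w_pos]
      simp: cuts_def)

text \<open>
  Counting the edges of a path: in the forest of a cut, the depth of \<open>i\<close> is the number of edges of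
  the path before \<open>(i, j)\<close>. At the last edge it is at most \<open>card T\<close>, so the path has at most
  \<open>card T + 1\<close> edges.
\<close>

lemma cut_sum_le_last:
  assumes c: "\<And>s t. 0 \<le> c s t"
  shows "cut_sum (\<lambda>p i j. c (tree_root T p i) (tree_root T p j))
    \<le> (real (card T) + 1) * last_cut_sum (\<lambda>p i j. c (tree_root T p i) (tree_root T p j))"
proof -
  let ?c = "\<lambda>p i j. c (tree_root T p i) (tree_root T p j)"
  let ?A = "\<lambda>p i j. ?c p i j * depth T p i" and ?B = "\<lambda>p i j. ?c p i j * (depth T p i + 1)"
  have "cut_sum ?c = cut_sum ?B - cut_sum ?A"
    by (subst cut_sum_diff[symmetric]) (simp add: algebra_simps)
  also have "\<dots> = last_cut_sum ?B - first_cut_sum ?A"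
    by (rule cut_sum_telescope) (simp add: shift_cut)
  also have "first_cut_sum ?A = 0"
    by (auto simp: first_cut_sum_def depth_outside intro!: sum.neutral)
  also have "last_cut_sum ?B - 0 \<le> last_cut_sum (\<lambda>p i j. (real (card T) + 1) * ?c p i j)"
  proof -
    have "depth T p i \<le> card T" if "(p, i, j) \<in> cuts" for p i j
    proof -
      from that have "p \<in> forests T X" by (simp add: cuts_def)
      then show ?thesis by (rule leads_length_le[OF forest_leads finite_T])
    qed
    then have "?B p i j \<le> (real (card T) + 1) * ?c p i j" if "(p, i, j) \<in> cuts" for p i j
      unfolding mult.commute[of "real (card T) + 1"]
      by (intro mult_left_mono c) (use that in simp)
    then show ?thesis by (simp add: last_cut_sum_mono)
  qed
  also have "\<dots> = (real (card T) + 1) * last_cut_sum ?c"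
    by (simp add: last_cut_sum_def sum_distrib_left case_prod_unfold mult_ac)
  finally show ?thesis .
qed

text \<open>
  Along a path from \<open>s\<close> to \<open>t\<close> the increments of \<open>z\<close> add up to \<open>y s - y t\<close>, whatever the values of
  \<open>z\<close> inside \<open>T\<close> are. It is this freedom in \<open>z\<close> that makes the identity useful.
\<close>

lemma cut_sum_flow:
  fixes y z :: "'v \<Rightarrow> 'h::real_inner"
  assumes z: "\<And>v. v \<in> X - T \<Longrightarrow> z v = y v"
  shows "cut_sum (\<lambda>p i j. (y (tree_root T p i) - y (tree_root T p j)) \<bullet> (z i - z j))
    = last_cut_sum (\<lambda>p i j. (norm (y (tree_root T p i) - y (tree_root T p j)))\<^sup>2)"
proof -
  let ?D = "\<lambda>p i j. y (tree_root T p i) - y (tree_root T p j)"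
  let ?A = "\<lambda>p i j. ?D p i j \<bullet> z i" and ?B = "\<lambda>p i j. ?D p i j \<bullet> z j"
  let ?Ar = "\<lambda>p i j. ?D p i j \<bullet> y (tree_root T p i)"
    and ?Br = "\<lambda>p i j. ?D p i j \<bullet> y (tree_root T p j)"
  have "cut_sum (\<lambda>p i j. ?D p i j \<bullet> (z i - z j)) = cut_sum ?A - cut_sum ?B"
    by (simp add: inner_diff_right cut_sum_diff)
  also have "\<dots> = first_cut_sum ?A - last_cut_sum ?B"
    using cut_sum_telescope[of ?B ?A] shift_cut(2,3) by simp
  also have "first_cut_sum ?A = first_cut_sum ?Ar"
    unfolding first_cut_sum_def
    by (rule sum.cong) (auto simp: cuts_def root_outside z)
  also have "\<dots> = last_cut_sum ?Ar"
    by (rule first_eq_last)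
  also have "last_cut_sum ?B = last_cut_sum ?Br"
    unfolding last_cut_sum_def
    by (rule sum.cong) (auto simp: cuts_def root_outside z)
  also have "last_cut_sum ?Ar - last_cut_sum ?Br = last_cut_sum (\<lambda>p i j. (norm (?D p i j))\<^sup>2)"
    by (simp add: last_cut_sum_diff[symmetric] inner_diff_right[symmetric] power2_norm_eq_inner)
  finally show ?thesis .
qed

text \<open>
  Edges inside a tree contribute nothing, so the sum may run over all edges and can then be taken
  over the forests first.
\<close>

lemma cut_sum_eq_sum_forests:
  assumes "\<And>p i j. tree_root T p i = tree_root T p j \<Longrightarrow> G p i j = 0"
  shows "cut_sum G = (\<Sum>i\<in>X. \<Sum>j\<in>X. w i j * (\<Sum>p\<in>forests T X. weight p * G p i j))"
proof -
  have "cut_sum G = (\<Sum>(p, i, j)\<in>forests T X \<times> X \<times> X. weight p * w i j * G p i j)"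
    unfolding cut_sum_def
    by (rule sum.mono_neutral_left)
      (auto simp: cuts_def finite_X finite_forests T_subset assms)
  also have "\<dots> = (\<Sum>p\<in>forests T X. \<Sum>i\<in>X. \<Sum>j\<in>X. weight p * w i j * G p i j)"
    by (simp add: sum.cartesian_product)
  also have "\<dots> = (\<Sum>i\<in>X. \<Sum>p\<in>forests T X. \<Sum>j\<in>X. weight p * w i j * G p i j)"
    by (rule sum.swap)
  also have "\<dots> = (\<Sum>i\<in>X. \<Sum>j\<in>X. \<Sum>p\<in>forests T X. weight p * w i j * G p i j)"
    by (intro sum.cong refl sum.swap)
  finally show ?thesis by (simp add: sum_distrib_left mult_ac)
qed

definition energy :: "('v \<Rightarrow> 'h::real_inner) \<Rightarrow> real" where
  "energy y = (\<Sum>i\<in>X. \<Sum>j\<in>X. w i j * (norm (y i - y j))\<^sup>2)"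

text \<open>
  Let \<open>h v\<close> be the mean of \<open>y\<close> at the root of \<open>v\<close>, \<open>F\<close> the total weight of the forests and \<open>Q\<close> the
  left-hand side. By \<open>cut_sum_flow\<close>, \<open>Q\<close> is \<open>F\<close> times the bilinear energy of \<open>h\<close> and \<open>z\<close> for every
  \<open>z\<close> that agrees with \<open>y\<close> at the roots. The choice \<open>z = h\<close> shows that \<open>Q\<close> is \<open>F\<close> times the
  energy of \<open>h\<close>; the choice \<open>z = y\<close> then gives \<open>Q \<le> (Q + F * energy y) / 2\<close>. The function \<open>h\<close> is
  the harmonic extension of the values at the roots, and the claim is its minimality.
\<close>

lemma last_cut_sum_le_energy:
  fixes y :: "'v \<Rightarrow> 'h::real_inner"
  assumes "forests T X \<noteq> {}"
  shows "last_cut_sum (\<lambda>p i j. (norm (y (tree_root T p i) - y (tree_root T p j)))\<^sup>2)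
    \<le> sum weight (forests T X) * energy y" (is "?Q \<le> ?F * _")
proof -
  define h where "h v = (\<Sum>p\<in>forests T X. weight p *\<^sub>R y (tree_root T p v)) /\<^sub>R ?F" for v
  have F: "?F > 0"
    using assms by (intro sum_pos weight_pos finite_forests finite_X T_subset)
  have hy: "h v = y v" if "v \<in> X - T" for v
    using that F by (simp add: h_def root_outside scaleR_sum_left[symmetric])
  have Q: "?Q = ?F * (\<Sum>i\<in>X. \<Sum>j\<in>X. w i j * ((h i - h j) \<bullet> (z i - z j)))"
    if z: "\<And>v. v \<in> X - T \<Longrightarrow> z v = y v" for z
  proof -
    have "(\<Sum>p\<in>forests T X. weight p * ((y (tree_root T p i) - y (tree_root T p j)) \<bullet> (z i - z j)))
        = ?F * ((h i - h j) \<bullet> (z i - z j))" for i j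
    proof -
      have "?F *\<^sub>R (h i - h j)
          = (\<Sum>p\<in>forests T X. weight p *\<^sub>R (y (tree_root T p i) - y (tree_root T p j)))"
        using F by (simp add: h_def scaleR_diff_right sum_subtractf)
      then have "(?F *\<^sub>R (h i - h j)) \<bullet> (z i - z j)
          = (\<Sum>p\<in>forests T X. weight p *\<^sub>R (y (tree_root T p i) - y (tree_root T p j))) \<bullet> (z i - z j)"
        by simp
      then show ?thesis by (simp add: inner_sum_left)
    qed
    then have "cut_sum (\<lambda>p i j. (y (tree_root T p i) - y (tree_root T p j)) \<bullet> (z i - z j))
        = (\<Sum>i\<in>X. \<Sum>j\<in>X. w i j * (?F * ((h i - h j) \<bullet> (z i - z j))))"
      by (subst cut_sum_eq_sum_forests) simp_all
    then show ?thesis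
      using cut_sum_flow[of z y, OF z] by (simp add: sum_distrib_left mult_ac)
  qed
  have "?Q = ?F * (\<Sum>i\<in>X. \<Sum>j\<in>X. w i j * ((h i - h j) \<bullet> (y i - y j)))"
    by (rule Q) simp
  also have "\<dots> \<le> ?F * (\<Sum>i\<in>X. \<Sum>j\<in>X. w i j * (((norm (h i - h j))\<^sup>2 + (norm (y i - y j))\<^sup>2) / 2))"
  proof (intro mult_left_mono sum_mono)
    fix i j
    have "0 \<le> (norm ((h i - h j) - (y i - y j)))\<^sup>2" by simp
    then show "(h i - h j) \<bullet> (y i - y j) \<le> ((norm (h i - h j))\<^sup>2 + (norm (y i - y j))\<^sup>2) / 2"
      unfolding power2_norm_eq_inner inner_diff_left inner_diff_right
      by (simp add: inner_commute algebra_simps)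
  qed (use F w_pos in \<open>auto intro: less_imp_le\<close>)
  also have "\<dots> = (?F * energy h + ?F * energy y) / 2"
    by (simp add: energy_def sum.distrib add_divide_distrib distrib_left sum_divide_distrib[symmetric])
  also have "?F * energy h = ?Q"
    using Q[of h] hy by (simp add: energy_def power2_norm_eq_inner)
  finally show ?thesis by simp
qed

text \<open>
  The weighted mean over all forests satisfies the inequality, so some forest does.
\<close>

proposition ex_forest_energy_le:
  fixes y :: "'v \<Rightarrow> 'h::real_inner"
  assumes "X - T \<noteq> {}"
  shows "\<exists>p\<in>forests T X. energy (\<lambda>v. y (tree_root T p v)) \<le> (real (card T) + 1) * energy y"
proof (rule ccontr)
  assume "\<not> ?thesis"
  then have gt: "(real (card T) + 1) * energy y < energy (\<lambda>v. y (tree_root T p v))"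
    if "p \<in> forests T X" for p using that by force
  let ?F = "sum weight (forests T X)"
  \<comment> \<open>The star that hangs every point of \<open>T\<close> directly on one root is a forest.\<close>
  obtain s where s: "s \<in> X" "s \<notin> T" using assms by auto
  have "leads T (\<lambda>v\<in>T. s) v s (Suc 0)" if "v \<in> T" for v
    using leads.step[OF that, of "\<lambda>v\<in>T. s" s 0] leads.stop[OF s(2)] that by simp
  then have "(\<lambda>v\<in>T. s) \<in> forests T X" using s by (auto simp: forests_def)
  then have ne: "forests T X \<noteq> {}" by auto
  let ?c = "\<lambda>s t. (norm (y s - y t))\<^sup>2"
  have "?F * ((real (card T) + 1) * energy y)
      = (\<Sum>p\<in>forests T X. weight p * ((real (card T) + 1) * energy y))"
    by (rule sum_distrib_right)
  also have "\<dots> < (\<Sum>p\<in>forests T X. weight p * energy (\<lambda>v. y (tree_root T p v)))"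
    using ne by (intro sum_strict_mono mult_strict_left_mono gt weight_pos finite_forests finite_X T_subset)
  also have "\<dots> = (\<Sum>p\<in>forests T X. \<Sum>i\<in>X. \<Sum>j\<in>X. weight p * (w i j * ?c (tree_root T p i) (tree_root T p j)))"
    by (simp add: energy_def sum_distrib_left)
  also have "\<dots> = (\<Sum>i\<in>X. \<Sum>p\<in>forests T X. \<Sum>j\<in>X. weight p * (w i j * ?c (tree_root T p i) (tree_root T p j)))"
    by (rule sum.swap)
  also have "\<dots> = (\<Sum>i\<in>X. \<Sum>j\<in>X. \<Sum>p\<in>forests T X. weight p * (w i j * ?c (tree_root T p i) (tree_root T p j)))"
    by (intro sum.cong refl sum.swap)
  also have "\<dots> = cut_sum (\<lambda>p i j. ?c (tree_root T p i) (tree_root T p j))"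
    by (subst cut_sum_eq_sum_forests) (simp_all add: sum_distrib_left mult_ac)
  also have "\<dots> \<le> (real (card T) + 1) * last_cut_sum (\<lambda>p i j. ?c (tree_root T p i) (tree_root T p j))"
    by (rule cut_sum_le_last) simp
  also have "\<dots> \<le> (real (card T) + 1) * (?F * energy y)"
    using last_cut_sum_le_energy[OF ne, of y] by (rule mult_left_mono) simp
  finally show False by (simp add: mult_ac)
qed

end


section \<open>Random retractions\<close>

proposition ex_random_retraction:
  fixes X T :: "'h::real_inner set"
  assumes "finite X" "T \<subseteq> X" "X - T \<noteq> {}"
  obtains \<mu> where "\<And>p. 0 \<le> \<mu> p" "sum \<mu> (forests T X) = 1"
    and "\<And>x y. x \<in> X \<Longrightarrow> y \<in> X \<Longrightarrow>
      (\<Sum>p\<in>forests T X. \<mu> p * (dist (tree_root T p x) (tree_root T p y))\<^sup>2)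
        \<le> (real (card T) + 1) * (dist x y)\<^sup>2"
proof -
  let ?c = "real (card T) + 1"
  define a where "a = (\<lambda>(x, y) p. (dist (tree_root T p x) (tree_root T p y))\<^sup>2 - ?c * (dist x y)\<^sup>2)"
  have single: "\<exists>p\<in>forests T X. (\<Sum>k\<in>X \<times> X. w k * a k p) \<le> 0" if w: "\<And>k. k \<in> X \<times> X \<Longrightarrow> 0 < w k" for w
  proof -
    \<comment> \<open>Conductances must be symmetric; symmetrizing \<open>w\<close> doubles the sum, as \<open>a\<close> is symmetric.\<close>
    define u where "u x y = (if x \<in> X \<and> y \<in> X then w (x, y) + w (y, x) else 1)" for x y
    interpret weighted_network T X u
      by unfold_locales (use assms w in \<open>auto simp: u_def intro: add_pos_pos\<close>)
    obtain p where p: "p \<in> forests T X" and le: "energy (\<lambda>v. tree_root T p v) \<le> ?c * energy (\<lambda>v. v)"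
      using ex_forest_energy_le[OF assms(3), of "\<lambda>v. v"] by auto
    have a_sym: "a (y, x) p = a (x, y) p" for x y
      by (simp add: a_def dist_commute)
    have "(\<Sum>x\<in>X. \<Sum>y\<in>X. u x y * a (x, y) p)
        = (\<Sum>x\<in>X. \<Sum>y\<in>X. w (x, y) * a (x, y) p) + (\<Sum>x\<in>X. \<Sum>y\<in>X. w (y, x) * a (y, x) p)"
      by (simp add: u_def a_sym distrib_right sum.distrib)
    also have "(\<Sum>x\<in>X. \<Sum>y\<in>X. w (y, x) * a (y, x) p) = (\<Sum>x\<in>X. \<Sum>y\<in>X. w (x, y) * a (x, y) p)"
      by (rule sum.swap)
    finally have "2 * (\<Sum>k\<in>X \<times> X. w k * a k p) = (\<Sum>x\<in>X. \<Sum>y\<in>X. u x y * a (x, y) p)"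
      by (simp add: sum.cartesian_product)
    also have "\<dots> = energy (\<lambda>v. tree_root T p v) - ?c * energy (\<lambda>v. v)"
      by (simp add: energy_def a_def dist_norm right_diff_distrib sum_subtractf sum_distrib_left mult_ac)
    finally have "(\<Sum>k\<in>X \<times> X. w k * a k p) \<le> 0" using le by linarith
    then show ?thesis by (rule bexI[OF _ p])
  qed
  obtain \<mu> where mu: "\<And>p. 0 \<le> \<mu> p" "sum \<mu> (forests T X) = 1"
    and le: "\<And>k. k \<in> X \<times> X \<Longrightarrow> (\<Sum>p\<in>forests T X. \<mu> p * a k p) \<le> 0"
    using finite_minimax[OF finite_forests[OF assms(1,2)]
        finite_cartesian_product[OF assms(1,1)] single] by auto
  show ?thesis
  proof (rule that[OF mu])
    fix x y assume "x \<in> X" "y \<in> X"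
    then show "(\<Sum>p\<in>forests T X. \<mu> p * (dist (tree_root T p x) (tree_root T p y))\<^sup>2)
        \<le> ?c * (dist x y)\<^sup>2"
      using le[of "(x, y)"] mu(2)
      by (simp add: a_def right_diff_distrib sum_subtractf sum_distrib_right[symmetric])
  qed
qed

section \<open>Extension of Hoelder maps\<close>

text \<open>
  Jensen's inequality for the concave function \<open>\<lambda>t. t powr b\<close>, derived from its tangent at \<open>c\<close>:
  Young's inequality \<open>t powr b * c powr (1 - b) \<le> b * t + (1 - b) * c\<close>.
\<close>

lemma mean_powr_le:
  fixes \<mu> t :: "'o \<Rightarrow> real"
  assumes \<mu>: "\<And>x. x \<in> A \<Longrightarrow> 0 \<le> \<mu> x" "sum \<mu> A = 1"
    and t: "\<And>x. x \<in> A \<Longrightarrow> 0 \<le> t x"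
    and mean: "(\<Sum>x\<in>A. \<mu> x * t x) \<le> c" and "0 < c"
    and b: "0 < b" "b \<le> 1"
  shows "(\<Sum>x\<in>A. \<mu> x * t x powr b) \<le> c powr b"
proof -
  have "(\<Sum>x\<in>A. \<mu> x * t x powr b) * c powr (1 - b) = (\<Sum>x\<in>A. \<mu> x * (t x powr b * c powr (1 - b)))"
    by (simp add: sum_distrib_right mult.assoc)
  also have "\<dots> \<le> (\<Sum>x\<in>A. \<mu> x * (b * t x + (1 - b) * c))"
  proof (intro sum_mono mult_left_mono)
    fix x assume x: "x \<in> A"
    show "t x powr b * c powr (1 - b) \<le> b * t x + (1 - b) * c"
    proof (cases "t x = 0")
      case True
      with b \<open>0 < c\<close> show ?thesis by simp
    next
      case False
      with t[OF x] b \<open>0 < c\<close> show ?thesis by (intro Youngs_inequality_0) auto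
    qed
  qed (use \<mu> in auto)
  also have "\<dots> = b * (\<Sum>x\<in>A. \<mu> x * t x) + (1 - b) * c * sum \<mu> A"
    by (simp add: algebra_simps sum.distrib sum_distrib_left sum_subtractf)
  also have "\<dots> \<le> b * c + (1 - b) * c"
    using mean b \<mu>(2) by (simp add: mult_left_mono)
  also have "\<dots> = c powr b * c powr (1 - b)"
    using \<open>0 < c\<close> by (simp add: powr_add[symmetric] algebra_simps)
  finally show ?thesis
    using \<open>0 < c\<close> by simp
qed

theorem corollary1p4:
  fixes X S :: "'h::{real_inner, complete_space} set"
    and f :: "'h \<Rightarrow> 'e::banach"
    and \<alpha> L :: real
  assumes "0 < \<alpha>" and "\<alpha> \<le> 1" and "0 \<le> L"
    and "finite X" and "S \<subseteq> X"
    and "X \<noteq> {} \<Longrightarrow> S \<noteq> {}"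
    and "hoelder_map \<alpha> L S UNIV f"
  shows "\<exists>g L'. (\<forall>x\<in>S. g x = f x) \<and>
           hoelder_map \<alpha> L' X (closure (convex hull (f ` S))) g \<and>
           L' \<le> sqrt (real (card (X - S)) + 1) powr \<alpha> * L"
proof (cases "X = {}")
  case True
  then show ?thesis
    using assms by (intro exI[of _ f] exI[of _ L]) (simp add: hoelder_map_def)
next
  case False
  define T where "T = X - S"
  have S: "X - T = S" using assms(5) by (auto simp: T_def)
  let ?c = "real (card T) + 1"
  obtain \<mu> where mu: "\<And>p. 0 \<le> \<mu> p" "sum \<mu> (forests T X) = 1"
    and le: "\<And>x y. x \<in> X \<Longrightarrow> y \<in> X \<Longrightarrow>
      (\<Sum>p\<in>forests T X. \<mu> p * (dist (tree_root T p x) (tree_root T p y))\<^sup>2) \<le> ?c * (dist x y)\<^sup>2"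
    using ex_random_retraction[of X T] assms(4,6) False S by (auto simp: T_def)
  define g where "g x = (\<Sum>p\<in>forests T X. \<mu> p *\<^sub>R f (tree_root T p x))" for x
  have fin: "finite (forests T X)"
    using assms(4) by (simp add: finite_forests T_def)
  have root_S: "tree_root T p x \<in> S" if "p \<in> forests T X" "x \<in> X" for p x
    using root_in[OF that] S by simp
  have "g x = f x" if "x \<in> S" for x
  proof -
    have "x \<notin> T" using that S by auto
    then show ?thesis
      by (simp add: g_def root_outside scaleR_sum_left[symmetric] mu)
  qed
  moreover have "g x \<in> closure (convex hull (f ` S))" if "x \<in> X" for x
  proof -
    have "g x \<in> convex hull (f ` S)"
      unfolding g_def using root_S that mu
      by (intro convex_sum fin convex_convex_hull) (auto intro!: hull_inc)
    then show ?thesis using closure_subset by blast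
  qed
  moreover have "dist (g x) (g y) \<le> (sqrt ?c powr \<alpha> * L) * dist x y powr \<alpha>"
    if "x \<in> X" "y \<in> X" for x y
  proof (cases "x = y")
    case False
    let ?d = "\<lambda>p. dist (tree_root T p x) (tree_root T p y)"
    have sq: "(t\<^sup>2) powr (\<alpha> / 2) = t powr \<alpha>" if "0 \<le> t" for t :: real
      using that by (cases "t = 0") (simp_all add: powr_powr flip: powr_numeral)
    have "g x - g y = (\<Sum>p\<in>forests T X. \<mu> p *\<^sub>R (f (tree_root T p x) - f (tree_root T p y)))"
      by (simp add: g_def scaleR_diff_right sum_subtractf)
    then have "dist (g x) (g y) \<le> (\<Sum>p\<in>forests T X. norm (\<mu> p *\<^sub>R (f (tree_root T p x) - f (tree_root T p y))))"
      by (simp add: dist_norm sum_norm_le)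
    also have "\<dots> \<le> (\<Sum>p\<in>forests T X. \<mu> p * (L * ?d p powr \<alpha>))"
      using assms(7) root_S that mu
      by (intro sum_mono) (auto simp: hoelder_map_def dist_norm intro!: mult_left_mono)
    also have "\<dots> = L * (\<Sum>p\<in>forests T X. \<mu> p * ((?d p)\<^sup>2) powr (\<alpha> / 2))"
      by (simp add: sq sum_distrib_left mult_ac)
    also have "\<dots> \<le> L * (?c * (dist x y)\<^sup>2) powr (\<alpha> / 2)"
      using False assms(1-3) mu le[OF that]
      by (intro mult_left_mono mean_powr_le) (auto intro!: mult_pos_pos)
    also have "(?c * (dist x y)\<^sup>2) powr (\<alpha> / 2) = ?c powr (\<alpha> / 2) * dist x y powr \<alpha>"
      by (simp add: powr_mult sq)
    also have "?c powr (\<alpha> / 2) = sqrt ?c powr \<alpha>"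
      using sq[of "sqrt ?c"] by simp
    finally show ?thesis by (simp add: mult_ac)
  qed simp
  ultimately show ?thesis
    using assms(1-3)
    by (intro exI[of _ g] exI[of _ "sqrt ?c powr \<alpha> * L"]) (auto simp: hoelder_map_def T_def)
qed

end
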